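(* Let $n\in\omega$, $n\geq 2$. For an $n$-Hausdorff space $X$ the following are equivalent: (a) $X$ is $n$-H-closed; (b) for each open ultrafilter $\mathcal U$ on $X$, $|a\mathcal U|=n-1$; (c) $X$ is $n$-qH-closed; (d) for all open filters $\mathcal F_1,\dots,\mathcal F_{n-1}$ on $X$ such that $\bigcup_{i=1}^{n-1}\mathcal F_i$ has the finite intersection property, $|a(\mathcal F_1\vee\dots\vee\mathcal F_{n-1})|\geq n-1$.
   Context: Spaces are arbitrary topological spaces. A space $X$ is $n$-Hausdorff if for any distinct points $x_1,\dots,x_n\in X$ there are open sets $U_i\ni x_i$ ($i=1,\dots,n$) with $\bigcap_{i=1}^n U_i=\varnothing$. An open filter on $X$ is a nonempty family of nonempty open subsets of $X$ closed under finite intersections and open supersets; an open ultrafilter is a maximal open filter. The adherence of $\mathcal F$ is $a\mathcal F=\bigcap_{F\in\mathcal F}\mathrm{cl}_X(F)$. $\mathcal F_1\vee\dots\vee\mathcal F_{n-1}$ denotes the open filter generated by $\bigcup_{i=1}^{n-1}\mathcal F_i$. An $n$-Hausdorff space $X$ is $n$-H-closed if $X$ is closed in every $n$-Hausdorff space $Y$ in which $X$ is embedded as a subspace. A space $X$ is $n$-qH-closed if every open filter $\mathcal F$ on $X$ satisfies $|a\mathcal F|\geq n-1$ (equivalently: for every $A\subseteq X$ with $|A|<n-1$ and every family $\mathcal U$ of open subsets of $X$ with $X\setminus A\subseteq\bigcup\mathcal U$, some finite $\mathcal V\subseteq\mathcal U$ has $X=\bigcup_{V\in\mathcal V}\overline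 V$). *)

theory Defs
  imports "HOL-Analysis.Analysis"
begin

definition n_Hausdorff :: "nat \<Rightarrow> 'a topology \<Rightarrow> bool" where
  "n_Hausdorff n X \<longleftrightarrow>
    (\<forall>x. inj_on x {1..n} \<and> x ` {1..n} \<subseteq> topspace X \<longrightarrow>
      (\<exists>U. (\<forall>i\<in>{1..n}. openin X (U i) \<and> x i \<in> U i) \<and> (\<Inter>i\<in>{1..n}. U i) = {}))"

definition open_filter :: "'a topology \<Rightarrow> 'a set set \<Rightarrow> bool" where
  "open_filter X F \<longleftrightarrow> F \<noteq> {} \<and> (\<forall>U\<in>F. openin X U \<and> U \<noteq> {}) \<and>
    (\<forall>U\<in>F. \<forall>V\<in>F. U \<inter> V \<in> F) \<and> (\<forall>U\<in>F. \<forall>V. openin X V \<and> U \<subseteq> V \<longrightarrow> V \<in> F)"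

definition open_ultrafilter :: "'a topology \<Rightarrow> 'a set set \<Rightarrow> bool" where
  "open_ultrafilter X F \<longleftrightarrow> open_filter X F \<and> (\<forall>G. open_filter X G \<and> F \<subseteq> G \<longrightarrow> G = F)"

(* Only meaningful for nonempty families: the intersection over the empty family is UNIV. *)
definition adherence :: "'a topology \<Rightarrow> 'a set set \<Rightarrow> 'a set" where
  "adherence X F = (\<Inter>U\<in>F. X closure_of U)"

definition has_fip :: "'a set set \<Rightarrow> bool" where
  "has_fip S \<longleftrightarrow> (\<forall>T. finite T \<and> T \<noteq> {} \<and> T \<subseteq> S \<longrightarrow> \<Inter>T \<noteq> {})"

(* The least open filter containing S. It is an open filter whenever S is a nonempty
   family of open sets with the finite intersection property. *)
definition generated_open_filter :: "'a topology \<Rightarrow> 'a set set \<Rightarrow> 'a set set" where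
  "generated_open_filter X S = open_filter X hull S"

(* HOL cannot quantify over all spaces Y of all types, so the type carrying the spaces Y is
   a parameter. If it is too small there may be no room for a proper extension of X;
   lemma n_H_closed_any_type below shows that a type of the form 'a + 'b is always large
   enough, in that being closed in all such Y implies being closed in Y of every type. *)
definition n_H_closed :: "'c itself \<Rightarrow> nat \<Rightarrow> 'a topology \<Rightarrow> bool" where
  "n_H_closed (_ :: 'c itself) n X \<longleftrightarrow> n_Hausdorff n X \<and>
    (\<forall>(Y :: 'c topology) e. n_Hausdorff n Y \<and> embedding_map X Y e \<longrightarrow>
      closedin Y (e ` topspace X))"

(* Cardinalities are compared by lepoll, as card is 0 on infinite sets. *)
definition n_qH_closed :: "nat \<Rightarrow> 'a topology \<Rightarrow> bool" where
  "n_qH_closed n X \<longleftrightarrow> (\<forall>F. open_filter X F \<longrightarrow> {1..n - 1} \<lesssim> adherence X F)"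

lemma n_Hausdorff_pullback:
  assumes Y: "n_Hausdorff n Y" and g: "inj_on g A"
  shows "n_Hausdorff n (pullback_topology A g Y)"
  unfolding n_Hausdorff_def
proof (intro allI impI, elim conjE)
  fix x
  assume inj: "inj_on x {1..n}" and sub: "x ` {1..n} \<subseteq> topspace (pullback_topology A g Y)"
  have xA: "x i \<in> A" "g (x i) \<in> topspace Y" if "i \<in> {1..n}" for i
    using sub that by (auto simp: topspace_pullback_topology image_subset_iff)
  have "inj_on (g \<circ> x) {1..n}"
    using inj g xA by (auto intro!: comp_inj_on intro: inj_on_subset)
  moreover have "(g \<circ> x) ` {1..n} \<subseteq> topspace Y"
    using xA by auto
  ultimately have "\<exists>U. (\<forall>i\<in>{1..n}. openin Y (U i) \<and> (g \<circ> x) i \<in> U i) \<and> (\<Inter>i\<in>{1..n}. U i) = {}"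
    using Y unfolding n_Hausdorff_def by (elim allE[of _ "g \<circ> x"] impE) (rule conjI)
  then obtain U where U: "\<forall>i\<in>{1..n}. openin Y (U i) \<and> (g \<circ> x) i \<in> U i"
      and int: "(\<Inter>i\<in>{1..n}. U i) = {}"
    by blast
  have "n \<noteq> 0"
    using int by (cases "n = 0") auto
  then have "(\<Inter>i\<in>{1..n}. g -` U i \<inter> A) = {}"
    using int by fastforce
  moreover have "\<forall>i\<in>{1..n}. openin (pullback_topology A g Y) (g -` U i \<inter> A) \<and> x i \<in> g -` U i \<inter> A"
    using U xA by (auto simp: openin_pullback_topology)
  ultimately show "\<exists>V. (\<forall>i\<in>{1..n}. openin (pullback_topology A g Y) (V i) \<and> x i \<in> V i) \<and>
      (\<Inter>i\<in>{1..n}. V i) = {}"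
    by (intro exI[of _ "\<lambda>i. g -` U i \<inter> A"]) simp
qed

lemma n_H_closed_any_type:
  fixes X :: "'a topology"
  assumes X: "n_H_closed TYPE('a + 'b) n X"
  shows "n_H_closed TYPE('c) n X"
proof -
  have "closedin Y (e ` topspace X)"
    if Y: "n_Hausdorff n Y" and emb: "embedding_map X Y e" for Y :: "'c topology" and e
  proof (rule ccontr)
    assume ncl: "\<not> closedin Y (e ` topspace X)"
    have hom: "homeomorphic_map X (subtopology Y (e ` topspace X)) e"
      using emb by (simp add: embedding_map_def)
    then have inj: "inj_on e (topspace X)"
      by (simp add: homeomorphic_map_def)
    have cont: "continuous_map X Y e"
      using hom homeomorphic_imp_continuous_map continuous_map_in_subtopology by blast
    then have subY: "e ` topspace X \<subseteq> topspace Y"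
      by (rule continuous_map_image_subset_topspace)
    obtain p where p: "p \<in> Y closure_of (e ` topspace X)" "p \<notin> e ` topspace X"
      using ncl subY by (metis closure_of_subset_eq subsetI)
    have opX: "openin X S \<longleftrightarrow> (\<exists>V. openin Y V \<and> S = e -` V \<inter> topspace X)" for S
    proof
      assume S: "openin X S"
      then have "openin (subtopology Y (e ` topspace X)) (e ` S)"
        using hom by (meson homeomorphic_map_openness openin_subset)
      then obtain V where "openin Y V" "e ` S = V \<inter> e ` topspace X"
        by (auto simp: openin_subtopology)
      moreover have "S = e -` V \<inter> topspace X"
      proof (intro equalityI subsetI)
        fix x assume "x \<in> S"
        then show "x \<in> e -` V \<inter> topspace X"
          using calculation(2) openin_subset[OF S] by blast
      next
        fix x assume x: "x \<in> e -` V \<inter> topspace X"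
        then have "e x \<in> e ` S"
          using calculation(2) by blast
        then show "x \<in> S"
          using x inj openin_subset[OF S] by (simp add: inj_on_image_mem_iff)
      qed
      ultimately show "\<exists>V. openin Y V \<and> S = e -` V \<inter> topspace X" by blast
    next
      assume "\<exists>V. openin Y V \<and> S = e -` V \<inter> topspace X"
      then obtain V where V: "openin Y V" "S = e -` V \<inter> topspace X" by blast
      from openin_continuous_map_preimage[OF cont V(1)] show "openin X S"
        using V(2) by (simp add: vimage_def Int_def conj_commute)
    qed
    define q :: "'a + 'b" where "q = Inr undefined"
    define A where "A = insert q (Inl ` topspace X)"
    define g where "g = case_sum e (\<lambda>_ :: 'b. p)"
    define Z where "Z = pullback_topology A g Y"
    have injg: "inj_on g A"
      using inj p(2) by (auto simp: A_def g_def q_def inj_on_def)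
    have ZH: "n_Hausdorff n Z"
      unfolding Z_def by (rule n_Hausdorff_pullback[OF Y injg])
    have topZ: "topspace Z = A"
      using p(1) subY in_closure_of[of p Y]
      by (fastforce simp: Z_def topspace_pullback_topology A_def g_def q_def)
    have opZ: "openin (subtopology Z (Inl ` topspace X)) U \<longleftrightarrow>
        (\<exists>V. openin Y V \<and> U = Inl ` (e -` V \<inter> topspace X))" for U
    proof -
      have eq: "(g -` V \<inter> A) \<inter> Inl ` topspace X = Inl ` (e -` V \<inter> topspace X)" for V
        by (auto simp: A_def g_def q_def)
      have "(\<exists>T. openin Z T \<and> U = T \<inter> Inl ` topspace X) \<longleftrightarrow>
          (\<exists>V. openin Y V \<and> U = (g -` V \<inter> A) \<inter> Inl ` topspace X)"
        unfolding Z_def openin_pullback_topology by blast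
      then show ?thesis
        by (simp only: openin_subtopology eq)
    qed
    have "embedding_map X Z Inl"
      unfolding embedding_map_def homeomorphic_map_def quotient_map_def
    proof (intro conjI allI impI)
      show top: "Inl ` topspace X = topspace (subtopology Z (Inl ` topspace X))"
        by (auto simp: topZ A_def)
      fix U :: "('a + 'b) set"
      assume "U \<subseteq> topspace (subtopology Z (Inl ` topspace X))"
      then have "U \<subseteq> Inl ` topspace X"
        by (simp only: top[symmetric])
      then have U: "U = Inl ` {x \<in> topspace X. Inl x \<in> U}"
        by auto
      have "U = Inl ` S \<longleftrightarrow> {x \<in> topspace X. Inl x \<in> U} = S" for S :: "'a set"
        by (subst U) (rule inj_image_eq_iff[OF inj_Inl])
      then show "openin X {x \<in> topspace X. Inl x \<in> U} = openin (subtopology Z (Inl ` topspace X)) U"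
        unfolding opX opZ by simp
    qed simp
    then have "closedin Z (Inl ` topspace X)"
      using X ZH unfolding n_H_closed_def by blast
    then have "openin Z (topspace Z - Inl ` topspace X)"
      by blast
    moreover have "topspace Z - Inl ` topspace X = {q}"
      by (auto simp: topZ A_def q_def)
    ultimately obtain V where V: "openin Y V" "{q} = g -` V \<inter> A"
      unfolding Z_def openin_pullback_topology by auto
    have "g q \<in> V"
      using V(2) by blast
    then have "p \<in> V"
      by (simp add: g_def q_def)
    then obtain x where x: "x \<in> topspace X" "e x \<in> V"
      using p(1) V(1) unfolding in_closure_of by blast
    have "Inl x \<in> {q}"
      unfolding V(2) using x by (simp add: g_def A_def)
    then show False
      by (simp add: q_def)
  qed
  with X show ?thesis
    unfolding n_H_closed_def by blast
qed

end

theory Submission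
  imports Defs
begin

text \<open>If an open filter on \<open>X\<close> has fewer than \<open>n - 1\<close> adherent points, adding one point whose
  neighbourhood trace on \<open>X\<close> is that filter gives an \<open>n\<close>-Hausdorff space in which \<open>X\<close> is not
  closed. Conversely, an open ultrafilter contains every open neighbourhood of each of its adherent
  points. Hence it cannot have \<open>n\<close> adherent points in an \<open>n\<close>-Hausdorff space, and if it
  contains the trace of the neighbourhoods of a point \<open>p\<close> in the closure of \<open>X\<close> but outside
  \<open>X\<close>, then \<open>p\<close> together with \<open>n - 1\<close> adherent points violates the \<open>n\<close>-Hausdorff property.\<close>

section \<open>Elementary facts on open filters and adherence\<close>

lemma n_HausdorffD:
  assumes "n_Hausdorff n X" "inj_on x {1..n}" "x ` {1..n} \<subseteq> topspace X"
  obtains U where "\<And>i. i \<in> {1..n} \<Longrightarrow> openin X (U i) \<and> x i \<in> U i" "(\<Inter>i\<in>{1..n}. U i) = {}"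
proof -
  have "\<exists>U. (\<forall>i\<in>{1..n}. openin X (U i) \<and> x i \<in> U i) \<and> (\<Inter>i\<in>{1..n}. U i) = {}"
    using assms(1)[unfolded n_Hausdorff_def, rule_format, of x] assms(2,3) by blast
  then show thesis
    using that by blast
qed

lemma open_filterI:
  assumes "F \<noteq> {}" "\<And>U. U \<in> F \<Longrightarrow> openin X U" "\<And>U. U \<in> F \<Longrightarrow> U \<noteq> {}"
    "\<And>U V. U \<in> F \<Longrightarrow> V \<in> F \<Longrightarrow> U \<inter> V \<in> F"
    "\<And>U V. U \<in> F \<Longrightarrow> openin X V \<Longrightarrow> U \<subseteq> V \<Longrightarrow> V \<in> F"
  shows "open_filter X F"
  using assms unfolding open_filter_def by blast

lemma open_filterD:
  assumes "open_filter X F"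
  shows "F \<noteq> {}" "U \<in> F \<Longrightarrow> openin X U" "{} \<notin> F"
    "U \<in> F \<Longrightarrow> V \<in> F \<Longrightarrow> U \<inter> V \<in> F"
    "U \<in> F \<Longrightarrow> openin X V \<Longrightarrow> U \<subseteq> V \<Longrightarrow> V \<in> F"
  using assms unfolding open_filter_def by blast+

lemma open_filter_topspace:
  assumes "open_filter X F"
  shows "topspace X \<in> F"
  using open_filterD[OF assms] by (metis ex_in_conv openin_subset openin_topspace)

lemma open_filter_INT:
  assumes "open_filter X F" "finite I" "I \<noteq> {}" "\<And>i. i \<in> I \<Longrightarrow> A i \<in> F"
  shows "(\<Inter>i\<in>I. A i) \<in> F"
  using assms(2-4) by (induction I rule: finite_ne_induct) (auto intro: open_filterD(4)[OF assms(1)])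

lemma has_fip_open_filter:
  assumes "open_filter X F"
  shows "has_fip F"
proof -
  have "\<Inter>T \<in> F" if "finite T" "T \<noteq> {}" "T \<subseteq> F" for T
    using open_filter_INT[OF assms, of T "\<lambda>A. A"] that by auto
  then show ?thesis
    using open_filterD(3)[OF assms] unfolding has_fip_def by metis
qed

lemma adherence_subset_topspace:
  assumes "open_filter X F"
  shows "adherence X F \<subseteq> topspace X"
  using open_filterD(1)[OF assms] closure_of_subset_topspace[of X] unfolding adherence_def by blast

lemma adherence_antimono: "F \<subseteq> G \<Longrightarrow> adherence X G \<subseteq> adherence X F"
  unfolding adherence_def by blast

section \<open>Open ultrafilters and their adherent points\<close>

text \<open>Zorn's lemma on the open filters containing \<open>F\<close>: the union of a nonempty
  chain is again an open filter, because any two of its members already lie in one filter of the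
  chain.\<close>

lemma open_filter_extends_to_ultrafilter:
  assumes "open_filter X F"
  obtains U where "open_ultrafilter X U" "F \<subseteq> U"
proof -
  let ?P = "{G. open_filter X G \<and> F \<subseteq> G}"
  have "\<exists>M\<in>?P. \<forall>G\<in>?P. M \<subseteq> G \<longrightarrow> G = M"
  proof (rule subset_Zorn_nonempty)
    show "?P \<noteq> {}"
      using assms by blast
  next
    fix C assume C: "C \<noteq> {}" "subset.chain ?P C"
    then have filt: "open_filter X G" "F \<subseteq> G" if "G \<in> C" for G
      using that unfolding subset.chain_def by auto
    have "open_filter X (\<Union>C)"
    proof (rule open_filterI)
      show "\<Union>C \<noteq> {}"
        using C(1) filt(1) open_filterD(1) by blast
    next
      fix U V assume "U \<in> \<Union>C" "V \<in> \<Union>C"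
      then obtain G H where GH: "G \<in> C" "H \<in> C" "U \<in> G" "V \<in> H"
        by blast
      then have "G \<subseteq> H \<or> H \<subseteq> G"
        using C(2) by (meson subset_chain_def)
      then show "U \<inter> V \<in> \<Union>C"
        using GH filt(1) open_filterD(4) by blast
    qed (use filt(1) open_filterD in blast)+
    then show "\<Union>C \<in> ?P"
      using C(1) filt(2) by blast
  qed
  then obtain M where M: "M \<in> ?P" "\<forall>G\<in>?P. M \<subseteq> G \<longrightarrow> G = M" ..
  have "open_ultrafilter X M"
    unfolding open_ultrafilter_def
  proof (intro conjI allI impI)
    show "open_filter X M"
      using M(1) by simp
  next
    fix G assume "open_filter X G \<and> M \<subseteq> G"
    moreover from this have "G \<in> ?P"
      using M(1) by auto
    ultimately show "G = M"
      using M(2) by simp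
  qed
  with M(1) show thesis
    using that by simp
qed

text \<open>Since \<open>x\<close> is adherent, \<open>V\<close> meets every member of
  \<open>U\<close>; hence \<open>U\<close> and \<open>V\<close> together generate an open filter,
  which by maximality is \<open>U\<close> itself.\<close>

lemma open_ultrafilter_mem_nhd:
  assumes U: "open_ultrafilter X U" and x: "x \<in> adherence X U" and V: "openin X V" "x \<in> V"
  shows "V \<in> U"
proof -
  have F: "open_filter X U"
    using U by (simp add: open_ultrafilter_def)
  have meet: "A \<inter> V \<noteq> {}" if "A \<in> U" for A
  proof -
    have "x \<in> X closure_of A"
      using x that by (auto simp: adherence_def)
    then show ?thesis
      using V unfolding in_closure_of by blast
  qed
  \<comment> \<open>The open filter generated by \<open>U\<close> and \<open>V\<close>; as
    \<open>U\<close> is closed under intersection, the sets \<open>A \<inter> V\<close> form a base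
    of it.\<close>
  define G where "G = {W. openin X W \<and> (\<exists>A\<in>U. A \<inter> V \<subseteq> W)}"
  have "open_filter X G"
  proof (rule open_filterI)
    show "G \<noteq> {}"
      using V(1) open_filterD(1)[OF F] unfolding G_def by blast
  next
    fix W W' assume "W \<in> G" "W' \<in> G"
    then obtain A A' where "A \<in> U" "A' \<in> U" "A \<inter> V \<subseteq> W" "A' \<inter> V \<subseteq> W'" "openin X W" "openin X W'"
      unfolding G_def by blast
    moreover have "A \<inter> A' \<in> U"
      using calculation open_filterD(4)[OF F] by blast
    ultimately show "W \<inter> W' \<in> G"
      unfolding G_def by blast
  next
    fix W W' assume "W \<in> G" "openin X W'" "W \<subseteq> W'"
    then show "W' \<in> G"
      unfolding G_def by blast
  next
    fix W assume "W \<in> G"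
    then obtain A where "A \<in> U" "A \<inter> V \<subseteq> W"
      unfolding G_def by blast
    then show "W \<noteq> {}"
      using meet by blast
  qed (simp add: G_def)
  moreover have "U \<subseteq> G"
    using open_filterD(2)[OF F] unfolding G_def by blast
  ultimately have "G = U"
    using U by (simp add: open_ultrafilter_def)
  moreover have "V \<in> G"
    using V(1) open_filterD(1)[OF F] unfolding G_def by blast
  ultimately show ?thesis
    by blast
qed

text \<open>If there were \<open>n\<close> distinct adherent points, their separating neighbourhoods
  would all belong to \<open>U\<close>, and so would their empty intersection.\<close>

lemma adherence_open_ultrafilter_lepoll:
  assumes "n \<ge> 1" and X: "n_Hausdorff n X" and U: "open_ultrafilter X U"
  shows "adherence X U \<lesssim> {1..n - 1}"
proof -
  have F: "open_filter X U"
    using U by (simp add: open_ultrafilter_def)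
  have no: "\<not> {1..n} \<lesssim> adherence X U"
  proof
    assume "{1..n} \<lesssim> adherence X U"
    then obtain x where x: "inj_on x {1..n}" "x ` {1..n} \<subseteq> adherence X U"
      unfolding lepoll_def by blast
    then have "x ` {1..n} \<subseteq> topspace X"
      using adherence_subset_topspace[OF F] by blast
    then obtain V where V: "\<And>i. i \<in> {1..n} \<Longrightarrow> openin X (V i) \<and> x i \<in> V i"
        "(\<Inter>i\<in>{1..n}. V i) = {}"
      using n_HausdorffD[OF X x(1)] by blast
    have "(\<Inter>i\<in>{1..n}. V i) \<in> U"
      using V(1) x(2) \<open>n \<ge> 1\<close> by (intro open_filter_INT[OF F] open_ultrafilter_mem_nhd[OF U]) auto
    then show False
      using V(2) open_filterD(3)[OF F] by simp
  qed
  \<comment> \<open>An infinite set would admit an injection from \<open>{1..n}\<close>. Once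
    finiteness is known, \<open>card\<close> is meaningful and the bound becomes arithmetic.\<close>
  then have fin: "finite (adherence X U)"
    using finite_lepoll_infinite by blast
  with no have "\<not> n \<le> card (adherence X U)"
    by (simp add: lepoll_iff_card_le)
  with fin show ?thesis
    by (simp add: lepoll_iff_card_le)
qed

section \<open>Generated open filters\<close>

text \<open>The hull is the intersection of all open filters containing \<open>S\<close>. Closure
  under intersections and open supersets passes to it directly; openness and nonemptiness of its
  members come from one explicit open filter \<open>G\<close> that contains
  \<open>S\<close>.\<close>

lemma open_filter_generated:
  assumes S: "S \<noteq> {}" "\<And>A. A \<in> S \<Longrightarrow> openin X A" "has_fip S"
  shows "open_filter X (generated_open_filter X S)"
proof -
  \<comment> \<open>Open supersets of finite intersections from \<open>S\<close>; the finite
    intersection property keeps the empty set out.\<close>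
  define G where "G = {V. openin X V \<and> (\<exists>T. finite T \<and> T \<noteq> {} \<and> T \<subseteq> S \<and> \<Inter>T \<subseteq> V)}"
  have SG: "S \<subseteq> G"
  proof
    fix A assume "A \<in> S"
    then show "A \<in> G"
      unfolding G_def using S(2) by (auto intro!: exI[of _ "{A}"])
  qed
  have G: "open_filter X G"
  proof (rule open_filterI)
    show "G \<noteq> {}"
      using SG S(1) by blast
  next
    fix U V assume "U \<in> G" "V \<in> G"
    then obtain T T' where T: "openin X U" "openin X V" "finite T" "T \<noteq> {}" "T \<subseteq> S" "\<Inter>T \<subseteq> U"
        "finite T'" "T' \<subseteq> S" "\<Inter>T' \<subseteq> V"
      unfolding G_def by blast
    then have "finite (T \<union> T')" "T \<union> T' \<noteq> {}" "T \<union> T' \<subseteq> S" "\<Inter>(T \<union> T') \<subseteq> U \<inter> V"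
      by blast+
    with T(1,2) show "U \<inter> V \<in> G"
      unfolding G_def by blast
  next
    fix U assume "U \<in> G"
    then obtain T where "finite T" "T \<noteq> {}" "T \<subseteq> S" "\<Inter>T \<subseteq> U"
      unfolding G_def by blast
    moreover from this have "\<Inter>T \<noteq> {}"
      using S(3) unfolding has_fip_def by simp
    ultimately show "U \<noteq> {}"
      by blast
  next
    fix U V assume "U \<in> G" "openin X V" "U \<subseteq> V"
    then show "V \<in> G"
      unfolding G_def by blast
  qed (simp add: G_def)
  define H where "H = generated_open_filter X S"
  have mem: "W \<in> H \<longleftrightarrow> (\<forall>E. open_filter X E \<and> S \<subseteq> E \<longrightarrow> W \<in> E)" for W
    by (auto simp: H_def generated_open_filter_def hull_def)
  have HG: "H \<subseteq> G"
    using mem G SG by blast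
  have "open_filter X H"
  proof (rule open_filterI)
    show "H \<noteq> {}"
      using S(1) mem by blast
  next
    fix U assume "U \<in> H"
    then show "openin X U" "U \<noteq> {}"
      using HG open_filterD(2,3)[OF G] by blast+
  next
    fix U V assume "U \<in> H" "V \<in> H"
    then show "U \<inter> V \<in> H"
      unfolding mem using open_filterD(4) by metis
  next
    fix U V assume "U \<in> H" "openin X V" "U \<subseteq> V"
    then show "V \<in> H"
      unfolding mem using open_filterD(5) by metis
  qed
  then show ?thesis
    by (simp add: H_def)
qed

lemma generated_open_filter_same: "open_filter X F \<Longrightarrow> generated_open_filter X F = F"
  unfolding generated_open_filter_def by (rule hull_same)

section \<open>The extension of a space by one point\<close>

text \<open>The added point is \<open>Inr undefined\<close>, an element that exists for every type
  \<open>'b\<close>. \<open>X\<close> sits inside as an open subspace, and the open sets around the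
  new point are those whose trace on \<open>X\<close> belongs to \<open>F\<close>.\<close>

definition one_point_extension :: "'a topology \<Rightarrow> 'a set set \<Rightarrow> ('a + 'b) topology" where
  "one_point_extension X F = topology (\<lambda>W. W \<subseteq> insert (Inr undefined) (Inl ` topspace X) \<and>
     openin X (Inl -` W) \<and> (Inr undefined \<in> W \<longrightarrow> Inl -` W \<in> F))"

context
  fixes X :: "'a topology" and F :: "'a set set"
  assumes F: "open_filter X F"
begin

lemma openin_one_point_extension:
  "openin (one_point_extension X F :: ('a + 'b) topology) W \<longleftrightarrow> W \<subseteq> insert (Inr undefined) (Inl ` topspace X) \<and>
     openin X (Inl -` W) \<and> (Inr undefined \<in> W \<longrightarrow> Inl -` W \<in> F)"
proof -
  \<comment> \<open>Around the new point, binary intersections use that \<open>F\<close> is closed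
    under intersection, and unions that it is closed under open supersets.\<close>
  have "istopology (\<lambda>W :: ('a + 'b) set. W \<subseteq> insert (Inr undefined) (Inl ` topspace X) \<and>
     openin X (Inl -` W) \<and> (Inr undefined \<in> W \<longrightarrow> Inl -` W \<in> F))"
    unfolding istopology_def
  proof (rule conjI; intro allI impI conjI)
    fix \<K> :: "('a + 'b) set set"
    assume K: "\<forall>W\<in>\<K>. W \<subseteq> insert (Inr undefined) (Inl ` topspace X) \<and>
       openin X (Inl -` W) \<and> (Inr undefined \<in> W \<longrightarrow> Inl -` W \<in> F)"
    show "\<Union>\<K> \<subseteq> insert (Inr undefined) (Inl ` topspace X)"
      using K by blast
    show op: "openin X (Inl -` \<Union>\<K>)"
      unfolding vimage_Union using K by blast
    assume "Inr undefined \<in> \<Union>\<K>"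
    then obtain W where W: "W \<in> \<K>" "Inl -` W \<in> F"
      using K by blast
    show "Inl -` \<Union>\<K> \<in> F"
      using W(1) by (intro open_filterD(5)[OF F W(2) op]) blast
  qed (auto intro: open_filterD(4)[OF F])
  then show ?thesis
    unfolding one_point_extension_def by (simp only: topology_inverse')
qed

lemma openin_one_point_extension_Inl:
  "openin (one_point_extension X F) (Inl ` V) \<longleftrightarrow> openin X V"
  using openin_subset[of X V] by (auto simp: openin_one_point_extension inj_vimage_image_eq)

lemma openin_one_point_extension_insert:
  "openin (one_point_extension X F) (insert (Inr undefined) (Inl ` V)) \<longleftrightarrow> V \<in> F"
proof -
  have "Inl -` insert (Inr undefined) (Inl ` V) = V"
    by auto
  then show ?thesis
    using openin_subset[OF open_filterD(2)[OF F, of V]] open_filterD(2)[OF F, of V]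
    by (auto simp: openin_one_point_extension)
qed

lemma topspace_one_point_extension:
  "topspace (one_point_extension X F :: ('a + 'b) topology) = insert (Inr undefined) (Inl ` topspace X)"
proof
  show "topspace (one_point_extension X F :: ('a + 'b) topology) \<subseteq> insert (Inr undefined) (Inl ` topspace X)"
    using openin_topspace openin_one_point_extension by blast
  show "insert (Inr undefined) (Inl ` topspace X) \<subseteq> topspace (one_point_extension X F :: ('a + 'b) topology)"
    using openin_one_point_extension_insert open_filter_topspace[OF F] openin_subset by blast
qed

lemma embedding_map_one_point_extension:
  "embedding_map X (one_point_extension X F :: ('a + 'b) topology) Inl"
proof (rule injective_open_imp_embedding_map)
  show "continuous_map X (one_point_extension X F :: ('a + 'b) topology) Inl"
    unfolding continuous_map_def
  proof (intro conjI allI impI)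
    fix W :: "('a + 'b) set" assume "openin (one_point_extension X F) W"
    then have "openin X (Inl -` W)"
      by (simp add: openin_one_point_extension)
    moreover from openin_subset[OF this] have "{x \<in> topspace X. Inl x \<in> W} = Inl -` W"
      by blast
    ultimately show "openin X {x \<in> topspace X. Inl x \<in> W}"
      by simp
  qed (auto simp: topspace_one_point_extension)
  show "open_map X (one_point_extension X F :: ('a + 'b) topology) Inl"
    by (simp add: open_map_def openin_one_point_extension_Inl)
qed simp

text \<open>The complement of \<open>X\<close> is the new point alone. Its trace on \<open>X\<close>
  is empty, so it would be open only if \<open>F\<close> contained the empty set.\<close>

lemma not_closedin_one_point_extension:
  "\<not> closedin (one_point_extension X F :: ('a + 'b) topology) (Inl ` topspace X)"
proof
  assume "closedin (one_point_extension X F :: ('a + 'b) topology) (Inl ` topspace X)"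
  moreover have "topspace (one_point_extension X F :: ('a + 'b) topology) - Inl ` topspace X = insert (Inr undefined) (Inl ` {})"
    by (auto simp: topspace_one_point_extension)
  ultimately have "{} \<in> F"
    unfolding closedin_def by (metis openin_one_point_extension_insert)
  then show False
    using open_filterD(3)[OF F] by blast
qed

text \<open>Points that all lie in \<open>X\<close> are separated as in \<open>X\<close>. If the new
  point is among them, the remaining \<open>n - 1\<close> points cannot all be adherent to
  \<open>F\<close>, and a non-adherent one can be separated from the new point by two disjoint open
  sets.\<close>

lemma n_Hausdorff_one_point_extension:
  assumes X: "n_Hausdorff n X" and few: "\<not> {1..n - 1} \<lesssim> adherence X F"
  shows "n_Hausdorff n (one_point_extension X F :: ('a + 'b) topology)"
  unfolding n_Hausdorff_def
proof (intro allI impI, elim conjE)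
  let ?Y = "one_point_extension X F :: ('a + 'b) topology"
  fix x :: "nat \<Rightarrow> 'a + 'b"
  assume x: "inj_on x {1..n}" "x ` {1..n} \<subseteq> topspace ?Y"
  show "\<exists>U. (\<forall>i\<in>{1..n}. openin ?Y (U i) \<and> x i \<in> U i) \<and> (\<Inter>i\<in>{1..n}. U i) = {}"
  proof (cases "Inr undefined \<in> x ` {1..n}")
    case True
    then obtain k where k: "k \<in> {1..n}" "x k = Inr undefined"
      by (metis imageE)
    have Inl: "x i \<in> Inl ` topspace X" if "i \<in> {1..n} - {k}" for i
    proof -
      have "x i \<noteq> Inr undefined"
        using inj_onD[OF x(1), of i k] k that by auto
      moreover have "x i \<in> topspace ?Y"
        using x(2) that by (auto simp: image_subset_iff)
      ultimately show ?thesis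
        by (simp add: topspace_one_point_extension)
    qed
    \<comment> \<open>Otherwise \<open>x\<close> would inject the \<open>n - 1\<close> indices other
      than \<open>k\<close> into the adherence, contrary to \<open>few\<close>.\<close>
    obtain j where j: "j \<in> {1..n} - {k}" "x j \<notin> Inl ` adherence X F"
    proof (rule ccontr)
      assume "\<not> thesis"
      then have "x ` ({1..n} - {k}) \<subseteq> Inl ` adherence X F"
        using that by blast
      moreover have "inj_on x ({1..n} - {k})"
        using x(1) by (rule inj_on_subset) blast
      ultimately have "{1..n} - {k} \<lesssim> (Inl ` adherence X F :: ('a + 'b) set)"
        unfolding lepoll_def by blast
      also have "\<dots> \<lesssim> adherence X F"
        by (rule image_lepoll)
      finally have "{1..n} - {k} \<lesssim> adherence X F" .
      moreover have "{1..n - 1} \<approx> {1..n} - {k}"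
        using k(1) by (simp add: eqpoll_iff_card)
      ultimately show False
        using few lepoll_trans1 by blast
    qed
    obtain y where y: "x j = Inl y" "y \<in> topspace X" "y \<notin> adherence X F"
      using Inl[OF j(1)] j(2) by blast
    from y(3) obtain A where A: "A \<in> F" "y \<notin> X closure_of A"
      by (auto simp: adherence_def)
    then obtain V where "openin X V" "y \<in> V" "V \<inter> A = {}"
      using y(2) unfolding in_closure_of by blast
    note AV = A(1) this
    \<comment> \<open>The sets at \<open>k\<close> and \<open>j\<close> are already disjoint, so
      every other point may take the whole space.\<close>
    define U :: "nat \<Rightarrow> ('a + 'b) set" where
      "U = (\<lambda>i. topspace ?Y)(k := insert (Inr undefined) (Inl ` A), j := Inl ` V)"
    have "openin ?Y (U i) \<and> x i \<in> U i" if "i \<in> {1..n}" for i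
      using that x(2) k(2) y(1) AV j(1)
      by (auto simp: U_def openin_one_point_extension_insert openin_one_point_extension_Inl)
    moreover have "(\<Inter>i\<in>{1..n}. U i) \<subseteq> U k \<inter> U j"
      using k(1) j(1) by blast
    moreover have "U k \<inter> U j = {}"
      using AV(4) j(1) by (auto simp: U_def)
    ultimately show ?thesis
      by blast
  next
    case False
    have sub: "x ` {1..n} \<subseteq> Inl ` topspace X"
      using x(2) unfolding topspace_one_point_extension subset_insert[OF False] .
    then have Inl: "\<exists>y\<in>topspace X. x i = Inl y" if "i \<in> {1..n}" for i
      using that by blast
    then obtain y where y: "\<And>i. i \<in> {1..n} \<Longrightarrow> y i \<in> topspace X \<and> x i = Inl (y i)"
      by metis
    have inj_y: "inj_on y {1..n}"
    proof (rule inj_onI)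
      fix i j assume "i \<in> {1..n}" "j \<in> {1..n}" "y i = y j"
      then show "i = j"
        using inj_onD[OF x(1), of i j] y[of i] y[of j] by simp
    qed
    have y_top: "y ` {1..n} \<subseteq> topspace X"
      using y by blast
    obtain U where U: "\<And>i. i \<in> {1..n} \<Longrightarrow> openin X (U i) \<and> y i \<in> U i" "(\<Inter>i\<in>{1..n}. U i) = {}"
      using n_HausdorffD[OF X inj_y y_top] by blast
    \<comment> \<open>For \<open>n = 0\<close> the intersection would be \<open>UNIV\<close>. A
      nonempty index set is what lets \<open>Inl\<close> commute with the intersection.\<close>
    have one: "1 \<in> {1..n}"
      using U(2) by (cases "n = 0") auto
    have "(\<Inter>i\<in>{1..n}. Inl ` U i :: ('a + 'b) set) = Inl ` (\<Inter>i\<in>{1..n}. U i)"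
      by (rule image_INT[where C = UNIV, OF inj_Inl _ one, symmetric]) simp
    then have "(\<Inter>i\<in>{1..n}. Inl ` U i :: ('a + 'b) set) = {}"
      by (simp only: U(2) image_empty)
    moreover have "openin ?Y (Inl ` U i) \<and> x i \<in> Inl ` U i" if "i \<in> {1..n}" for i
      using U(1)[OF that] y[OF that] by (simp add: openin_one_point_extension_Inl)
    ultimately show ?thesis
      by (intro exI[of _ "\<lambda>i. Inl ` U i"]) blast
  qed
qed

end

section \<open>The implications between the four conditions\<close>

text \<open>An open filter with too small an adherence gives a one-point extension that is
  \<open>n\<close>-Hausdorff and in which \<open>X\<close> is not closed. This extension lives on
  \<open>'a + 'b\<close>, which fixes the type in the hypothesis.\<close>

lemma n_H_closed_imp_n_qH_closed:
  fixes X :: "'a topology"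
  assumes "n_H_closed TYPE('a + 'b) n X"
  shows "n_qH_closed n X"
  unfolding n_qH_closed_def
proof (intro allI impI, rule ccontr)
  fix F assume F: "open_filter X F" and few: "\<not> {1..n - 1} \<lesssim> adherence X F"
  have "n_Hausdorff n (one_point_extension X F :: ('a + 'b) topology)"
    using assms few by (intro n_Hausdorff_one_point_extension[OF F]) (auto simp: n_H_closed_def)
  then have "closedin (one_point_extension X F :: ('a + 'b) topology) (Inl ` topspace X)"
    using assms embedding_map_one_point_extension[OF F] unfolding n_H_closed_def by blast
  then show False
    using not_closedin_one_point_extension[OF F] by blast
qed

text \<open>The \<open>n\<close>-Hausdorff property supplies the upper bound for ultrafilters. The
  lower bound passes from ultrafilters to all open filters because enlarging a filter shrinks its
  adherence.\<close>

lemma n_qH_closed_iff_open_ultrafilters: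
  assumes "n \<ge> 1" "n_Hausdorff n X"
  shows "n_qH_closed n X \<longleftrightarrow> (\<forall>U. open_ultrafilter X U \<longrightarrow> adherence X U \<approx> {1..n - 1})"
proof
  assume "n_qH_closed n X"
  then show "\<forall>U. open_ultrafilter X U \<longrightarrow> adherence X U \<approx> {1..n - 1}"
    using adherence_open_ultrafilter_lepoll[OF assms] lepoll_antisym
    unfolding n_qH_closed_def open_ultrafilter_def by blast
next
  assume ult: "\<forall>U. open_ultrafilter X U \<longrightarrow> adherence X U \<approx> {1..n - 1}"
  show "n_qH_closed n X"
    unfolding n_qH_closed_def
  proof (intro allI impI)
    fix F assume "open_filter X F"
    then obtain U where U: "open_ultrafilter X U" "F \<subseteq> U"
      by (rule open_filter_extends_to_ultrafilter)
    then have "{1..n - 1} \<approx> adherence X U"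
      using ult eqpoll_sym by blast
    also have "adherence X U \<lesssim> adherence X F"
      using U(2) by (intro subset_imp_lepoll adherence_antimono)
    finally show "{1..n - 1} \<lesssim> adherence X F" .
  qed
qed

text \<open>The argument takes place inside a given \<open>Y\<close>, so the type \<open>'c\<close>
  is arbitrary. A point \<open>p\<close> of the closure outside the image would be one point too
  many for the \<open>n\<close>-Hausdorff property of \<open>Y\<close>.\<close>

lemma n_H_closedI_open_ultrafilters:
  fixes X :: "'a topology"
  assumes "n \<ge> 1" and X: "n_Hausdorff n X"
    and ult: "\<And>U. open_ultrafilter X U \<Longrightarrow> {1..n - 1} \<lesssim> adherence X U"
  shows "n_H_closed TYPE('c) n X"
proof -
  have "closedin Y (e ` topspace X)"
    if Y: "n_Hausdorff n Y" and emb: "embedding_map X Y e" for Y :: "'c topology" and e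
  proof (rule ccontr)
    assume ncl: "\<not> closedin Y (e ` topspace X)"
    have hom: "homeomorphic_map X (subtopology Y (e ` topspace X)) e"
      using emb by (simp add: embedding_map_def)
    then have inj: "inj_on e (topspace X)"
      by (simp add: homeomorphic_map_def)
    have cont: "continuous_map X Y e"
      using homeomorphic_imp_continuous_map[OF hom] by (simp add: continuous_map_in_subtopology)
    have subY: "e ` topspace X \<subseteq> topspace Y"
      using cont by (rule continuous_map_image_subset_topspace)
    obtain p where p: "p \<in> Y closure_of (e ` topspace X)" "p \<notin> e ` topspace X"
      using ncl subY by (metis closure_of_subset_eq subsetI)
    have pY: "p \<in> topspace Y"
      using p(1) by (simp add: in_closure_of)
    define tr where "tr V = {x \<in> topspace X. e x \<in> V}" for V
    have tr: "openin X (tr V)" if "openin Y V" for V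
      unfolding tr_def using cont that by (rule openin_continuous_map_preimage)
    \<comment> \<open>The open filter generated by the traces on \<open>X\<close> of the
      neighbourhoods of \<open>p\<close>; these traces are nonempty because \<open>p\<close> lies in
      the closure of the image.\<close>
    define G where "G = {W. openin X W \<and> (\<exists>V. openin Y V \<and> p \<in> V \<and> tr V \<subseteq> W)}"
    have trG: "tr V \<in> G" if "openin Y V" "p \<in> V" for V
      using that tr unfolding G_def by blast
    have "open_filter X G"
    proof (rule open_filterI)
      show "G \<noteq> {}"
        using trG[OF openin_topspace pY] by blast
    next
      fix W W' assume "W \<in> G" "W' \<in> G"
      then obtain V V' where V: "openin X W" "openin X W'" "openin Y V" "p \<in> V" "tr V \<subseteq> W"
          "openin Y V'" "p \<in> V'" "tr V' \<subseteq> W'"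
        unfolding G_def by blast
      then have "openin Y (V \<inter> V')" "p \<in> V \<inter> V'" "tr (V \<inter> V') \<subseteq> W \<inter> W'"
        unfolding tr_def by blast+
      with V(1,2) show "W \<inter> W' \<in> G"
        unfolding G_def by blast
    next
      fix W assume "W \<in> G"
      then obtain V where "openin Y V" "p \<in> V" "tr V \<subseteq> W"
        unfolding G_def by blast
      moreover have "tr V \<noteq> {}"
        using p(1) calculation(1,2) unfolding in_closure_of tr_def by blast
      ultimately show "W \<noteq> {}"
        by blast
    next
      fix W W' assume "W \<in> G" "openin X W'" "W \<subseteq> W'"
      then show "W' \<in> G"
        unfolding G_def by blast
    qed (simp add: G_def)
    then obtain U where U: "open_ultrafilter X U" "G \<subseteq> U"
      by (rule open_filter_extends_to_ultrafilter)
    then have F: "open_filter X U"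
      by (simp add: open_ultrafilter_def)
    obtain f where f: "inj_on f {1..n - 1}" "f ` {1..n - 1} \<subseteq> adherence X U"
      using ult[OF U(1)] unfolding lepoll_def by blast
    then have fX: "f ` {1..n - 1} \<subseteq> topspace X"
      using adherence_subset_topspace[OF F] by blast
    have n_eq: "{1..n} = insert n {1..n - 1}" "n \<notin> {1..n - 1}"
      using \<open>n \<ge> 1\<close> by auto
    \<comment> \<open>The images of \<open>n - 1\<close> adherent points, with \<open>p\<close> at
      the last index: \<open>n\<close> distinct points of \<open>Y\<close>, as \<open>e\<close> is
      injective and \<open>p\<close> lies outside its image.\<close>
    define x where "x = (e \<circ> f)(n := p)"
    have x_less: "x i = e (f i)" if "i \<in> {1..n - 1}" for i
      using that n_eq(2) by (auto simp: x_def)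
    have xn: "x n = p"
      by (simp add: x_def)
    have img: "x ` {1..n - 1} = e ` f ` {1..n - 1}"
      using x_less by (auto simp: image_iff)
    have "inj_on (e \<circ> f) {1..n - 1}"
      using f(1) fX inj by (intro comp_inj_on) (auto intro: inj_on_subset)
    then have "inj_on x {1..n - 1}"
      using x_less by (simp add: inj_on_def)
    moreover have "x n \<notin> x ` {1..n - 1}"
      unfolding img xn using p(2) fX by blast
    ultimately have inj_x: "inj_on x {1..n}"
      unfolding n_eq(1) inj_on_insert Diff_insert0[OF n_eq(2)] by blast
    have x_top: "x ` {1..n} \<subseteq> topspace Y"
      unfolding n_eq(1) image_insert img xn using fX subY pY by blast
    obtain V where V: "\<And>i. i \<in> {1..n} \<Longrightarrow> openin Y (V i) \<and> x i \<in> V i"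
        "(\<Inter>i\<in>{1..n}. V i) = {}"
      using n_HausdorffD[OF Y inj_x x_top] by blast
    \<comment> \<open>At \<open>n\<close> the trace lies in \<open>G\<close>, hence in
      \<open>U\<close>; at any other index it is an open neighbourhood of the adherent point
      \<open>f i\<close>.\<close>
    have "tr (V i) \<in> U" if "i \<in> {1..n}" for i
    proof (cases "i = n")
      case True
      then show ?thesis
        using trG[of "V n"] V(1)[OF that] xn U(2) by blast
    next
      case False
      then have i: "i \<in> {1..n - 1}"
        using that n_eq(1) by blast
      then have "f i \<in> tr (V i)"
        using V(1)[OF that] x_less[OF i] fX unfolding tr_def by auto
      then show ?thesis
        using f(2) i V(1)[OF that] by (intro open_ultrafilter_mem_nhd[OF U(1) _ tr]) auto
    qed
    then have "(\<Inter>i\<in>{1..n}. tr (V i)) \<in> U"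
      using \<open>n \<ge> 1\<close> by (intro open_filter_INT[OF F]) auto
    moreover have "(\<Inter>i\<in>{1..n}. tr (V i)) \<subseteq> tr (\<Inter>i\<in>{1..n}. V i)"
      using n_eq(1) unfolding tr_def by auto
    then have "(\<Inter>i\<in>{1..n}. tr (V i)) = {}"
      unfolding V(2) by (simp add: tr_def)
    ultimately show False
      using open_filterD(3)[OF F] by simp
  qed
  with X show ?thesis
    unfolding n_H_closed_def by blast
qed

text \<open>Forwards, the generated family is itself an open filter; backwards, the constant family
  with value \<open>F\<close> generates \<open>F\<close>. Both directions use that
  \<open>n \<ge> 2\<close> makes the index set \<open>{1..n - 1}\<close> nonempty.\<close>

lemma n_qH_closed_iff_generated:
  assumes "n \<ge> 2"
  shows "n_qH_closed n X \<longleftrightarrow>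
    (\<forall>F. (\<forall>i\<in>{1..n - 1}. open_filter X (F i)) \<and> has_fip (\<Union>i\<in>{1..n - 1}. F i) \<longrightarrow>
      {1..n - 1} \<lesssim> adherence X (generated_open_filter X (\<Union>i\<in>{1..n - 1}. F i)))"
    (is "_ \<longleftrightarrow> (\<forall>F. ?P F \<longrightarrow> ?Q F)")
proof
  assume q: "n_qH_closed n X"
  show "\<forall>F. ?P F \<longrightarrow> ?Q F"
  proof (intro allI impI)
    fix F assume F: "?P F"
    have one: "1 \<in> {1..n - 1}"
      using assms by simp
    then have "F 1 \<noteq> {}"
      using F open_filterD(1)[of X "F 1"] by simp
    then have "(\<Union>i\<in>{1..n - 1}. F i) \<noteq> {}"
      using one by blast
    then have "open_filter X (generated_open_filter X (\<Union>i\<in>{1..n - 1}. F i))"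
      using F by (intro open_filter_generated) (auto dest: open_filterD(2))
    then show "?Q F"
      using q by (simp add: n_qH_closed_def)
  qed
next
  assume d: "\<forall>F. ?P F \<longrightarrow> ?Q F"
  show "n_qH_closed n X"
    unfolding n_qH_closed_def
  proof (intro allI impI)
    fix F assume F: "open_filter X F"
    have "1 \<in> {1..n - 1}"
      using assms by simp
    then have eq: "(\<Union>i\<in>{1..n - 1}. F) = F"
      by blast
    show "{1..n - 1} \<lesssim> adherence X F"
      using d[rule_format, of "\<lambda>_. F"] F has_fip_open_filter[OF F]
      unfolding eq generated_open_filter_same[OF F] by blast
  qed
qed

theorem theorem3:
  fixes X :: "'a topology" and n :: nat
  assumes "n \<ge> 2" and "n_Hausdorff n X"
  shows "(n_H_closed TYPE('a + 'b) n X \<longleftrightarrow>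
            (\<forall>U. open_ultrafilter X U \<longrightarrow> adherence X U \<approx> {1..n - 1})) \<and>
         ((\<forall>U. open_ultrafilter X U \<longrightarrow> adherence X U \<approx> {1..n - 1}) \<longleftrightarrow>
            n_qH_closed n X) \<and>
         (n_qH_closed n X \<longleftrightarrow>
            (\<forall>F. (\<forall>i\<in>{1..n - 1}. open_filter X (F i)) \<and> has_fip (\<Union>i\<in>{1..n - 1}. F i) \<longrightarrow>
              {1..n - 1} \<lesssim> adherence X (generated_open_filter X (\<Union>i\<in>{1..n - 1}. F i))))"
proof -
  let ?b = "\<forall>U. open_ultrafilter X U \<longrightarrow> adherence X U \<approx> {1..n - 1}"
  have n: "n \<ge> 1"
    using assms(1) by simp
  have cb: "n_qH_closed n X \<longleftrightarrow> ?b"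
    using n assms(2) by (rule n_qH_closed_iff_open_ultrafilters)
  \<comment> \<open>The forward direction goes through \<open>n_qH_closed\<close>; the backward one
    needs only the lower bound contained in \<open>?b\<close>.\<close>
  have "n_H_closed TYPE('a + 'b) n X \<longleftrightarrow> ?b"
  proof
    assume "n_H_closed TYPE('a + 'b) n X"
    then show ?b
      using n_H_closed_imp_n_qH_closed cb by blast
  next
    assume ?b
    then show "n_H_closed TYPE('a + 'b) n X"
      using n assms(2) by (intro n_H_closedI_open_ultrafilters) (auto intro: eqpoll_imp_lepoll eqpoll_sym)
  qed
  then show ?thesis
    using cb n_qH_closed_iff_generated[OF assms(1)] by blast
qed

end
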